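(* Let $n_1\le n_2$ and let $X_0$ be an $n_1\times n_2$ real matrix with rank $r$. For a linear operator $\Phi:\mathbb{R}^{n_1\times n_2}\to\mathbb{R}^m$ and $M_0=\Phi X_0\in\mathbb{R}^m$, consider the nuclear norm minimization problem $$\min_{X\in\mathbb{R}^{n_1\times n_2}}\ \|X\|_*\quad\text{subject to}\quad\Phi X=M_0.\qquad (P)$$ (1) One needs at least $\frac12r(r+1)$ measurements $m$ of $M_0$ so that solving (P) recovers exactly the strong solution $X_0$; that is, if $X_0$ is a strong solution of (P), then $m\ge\frac12r(r+1)$. (2) Moreover, there exist infinitely many linear operators $\Phi:\mathbb{R}^{n_1\times n_2}\to\mathbb{R}^{\frac12r(r+1)}$ such that $X_0$ is a strong solution of problem (P) with $M_0=\Phi X_0$.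
   Context: $\|\cdot\|_*$ is the nuclear norm (sum of singular values) and $\|\cdot\|_F$ the Frobenius norm. The number of measurements is the dimension $m$ of the space $\mathbb{R}^m$ containing the observation $M_0$. A matrix $X_0$ with $\Phi X_0=M_0$ is a strong solution of (P) if there exist $c,\varepsilon>0$ with $\|X\|_*-\|X_0\|_*\ge c\|X-X_0\|_F^2$ for all $X\in\mathbb{R}^{n_1\times n_2}$ with $\Phi X=M_0$ and $\|X-X_0\|_F\le\varepsilon$.
   Formalization: In (2), "infinitely many linear operators" is asserted for rank r ≥ 1 only; for r = 0 the target is R^0, into which there is exactly one linear operator, so the claim fails there and only existence is stated. *)

theory Defs
  imports
    "HOL-Analysis.Analysis"
    "HOL-Computational_Algebra.Computational_Algebra"
begin

definition charpoly :: "real^'n^'n \<Rightarrow> real poly" where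
  "charpoly A = det (\<chi> i j. (if i = j then [:0, 1:] else 0) - [:A $ i $ j:])"

(* X X^T is positive semidefinite, so its characteristic polynomial splits over the reals and
   has only nonnegative roots.  For an m x n matrix with m \<le> n this is the usual list of m
   singular values, repeated according to multiplicity and including zeros; for m > n it has
   m - n additional zeros. *)
definition singular_values :: "real^'n^'m \<Rightarrow> real multiset" where
  "singular_values X = image_mset sqrt (proots (charpoly (X ** transpose X)))"

definition nuclear_norm :: "real^'n^'m \<Rightarrow> real" where
  "nuclear_norm X = \<Sum>\<^sub># (singular_values X)"

(* The type class norm on matrices is the Frobenius norm. *)
lemma norm_eq_frobenius:
  fixes X :: "real^'n^'m"
  shows "norm X = sqrt (\<Sum>i\<in>UNIV. \<Sum>j\<in>UNIV. (X $ i $ j)\<^sup>2)"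
  by (simp add: norm_vec_def L2_set_def sum_nonneg)

(* R^m for a natural number m is topspace (Euclidean_space m), the sequences vanishing from
   index m on, with coordinatewise operations.  This allows m to depend on the rank of a matrix,
   and to be 0. *)
definition linear_operator :: "nat \<Rightarrow> (real^'n2^'n1 \<Rightarrow> (nat \<Rightarrow> real)) \<Rightarrow> bool" where
  "linear_operator m \<Phi> \<longleftrightarrow>
     range \<Phi> \<subseteq> topspace (Euclidean_space m) \<and> (\<forall>i. linear (\<lambda>X. \<Phi> X i))"

definition strong_solution :: "(real^'n2^'n1 \<Rightarrow> 'b) \<Rightarrow> 'b \<Rightarrow> real^'n2^'n1 \<Rightarrow> bool" where
  "strong_solution \<Phi> M\<^sub>0 X\<^sub>0 \<longleftrightarrow>
     \<Phi> X\<^sub>0 = M\<^sub>0 \<and>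
     (\<exists>c>0. \<exists>\<epsilon>>0. \<forall>X. \<Phi> X = M\<^sub>0 \<and> norm (X - X\<^sub>0) \<le> \<epsilon> \<longrightarrow>
        nuclear_norm X - nuclear_norm X\<^sub>0 \<ge> c * (norm (X - X\<^sub>0))\<^sup>2)"

end

theory Submission
  imports Defs
begin

text \<open>
Write \<open>X = U D V\<^sup>T\<close> for the thin singular value decomposition of a matrix of rank \<open>r\<close>.

On the \<open>r (r + 1) / 2\<close>-dimensional space of matrices \<open>U H V\<^sup>T\<close> with \<open>H\<close> symmetric, the nuclear norm is
affine near \<open>X\<close>, because \<open>D + t H\<close> stays positive semidefinite. With fewer measurements the
kernel contains such a direction, and quadratic growth fails along it in one of its two senses.

Conversely, measure exactly the symmetric part of \<open>U\<^sup>T X V\<close>. For \<open>H\<close> in the kernel, test \<open>X + H\<close> against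
\<open>U V\<^sup>T + \<tau> H\<close>: the inner product is \<open>tr D + \<tau> |H|\<^sup>2\<close>, whereas the operator norm is at most
\<open>1 + \<tau>\<^sup>2 |H|\<^sup>2\<close>, so for small \<open>\<tau>\<close> duality yields quadratic growth with constant \<open>\<tau> / 2\<close>. Nonzero
multiples of this operator have the same kernel, which gives infinitely many operators.
\<close>

no_notation fps_nth (infixl "$" 75)

declare transpose_matrix_vector [simp del]

section \<open>Spectral theorem for symmetric maps and matrices\<close>

text \<open>A maximizer \<open>a\<close> of the Rayleigh quotient on the unit sphere of
  \<open>S\<close> is an eigenvector: with \<open>l\<close> the maximum, \<open>g = l - f\<close> is
  positive semidefinite on \<open>S\<close> and \<open>a \<bullet> g a = 0\<close>, which forces
  \<open>g a = 0\<close>.\<close>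

lemma symmetric_eigenvector_in_subspace:
  fixes f :: "'a::euclidean_space \<Rightarrow> 'a"
  assumes f: "linear f" and sym: "\<And>x y. f x \<bullet> y = x \<bullet> f y"
    and S: "subspace S" "S \<noteq> {0}" and inv: "f ` S \<subseteq> S"
  obtains a l where "a \<in> S" "norm a = 1" "f a = l *\<^sub>R a"
proof -
  let ?K = "sphere 0 1 \<inter> S"
  obtain y where y: "y \<in> S" "y \<noteq> 0"
    using S subspace_0 by blast
  then have "y /\<^sub>R norm y \<in> ?K"
    using S(1) by (simp add: subspace_scale)
  then have ne: "?K \<noteq> {}" by blast
  have "compact ?K"
    using S(1) closed_subspace by (intro compact_Int_closed) auto
  moreover have "continuous_on ?K (\<lambda>x. x \<bullet> f x)"
    using f by (intro continuous_intros linear_continuous_on) (simp add: linear_conv_bounded_linear)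
  ultimately obtain a where a: "a \<in> ?K" and max: "\<And>x. x \<in> ?K \<Longrightarrow> x \<bullet> f x \<le> a \<bullet> f a"
    using continuous_attains_sup[OF _ ne] by blast
  define l where "l = a \<bullet> f a"
  define g where "g x = l *\<^sub>R x - f x" for x
  have aa: "a \<bullet> a = 1" "a \<in> S" using a by (auto simp: dot_square_norm)
  have g_nonneg: "0 \<le> x \<bullet> g x" if "x \<in> S" for x
  proof (cases "x = 0")
    case False
    have "x /\<^sub>R norm x \<in> ?K" using False that S(1) by (simp add: subspace_scale)
    from max[OF this] have "(x \<bullet> f x) / (norm x)\<^sup>2 \<le> l"
      using f by (simp add: l_def linear_scale power2_eq_square divide_inverse mult_ac)
    then have "x \<bullet> f x \<le> l * (norm x)\<^sup>2"
      using False by (simp add: pos_divide_le_eq)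
    then show ?thesis by (simp add: g_def inner_diff_right dot_square_norm)
  qed (simp)
  have gaS: "g a \<in> S"
    using aa(2) inv S(1) unfolding g_def by (intro subspace_diff subspace_scale) auto
  have g0: "a \<bullet> g a = 0" by (simp add: g_def l_def inner_diff_right aa(1))
  \<comment> \<open>Moving from \<open>a\<close> along \<open>g a\<close> gives a nonnegative
    quadratic in \<open>t\<close> without constant term, so its linear coefficient must
    vanish.\<close>
  have quad: "0 \<le> 2 * t * (g a \<bullet> g a) + t\<^sup>2 * (g a \<bullet> g (g a))" for t
  proof -
    have gsym: "g x \<bullet> y = x \<bullet> g y" for x y
      by (simp add: g_def inner_diff_left inner_diff_right sym)
    have glin: "g (x + t *\<^sub>R y) = g x + t *\<^sub>R g y" for x y
      using f by (simp add: g_def linear_add linear_scale algebra_simps)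
    have "0 \<le> (a + t *\<^sub>R g a) \<bullet> g (a + t *\<^sub>R g a)"
      using aa gaS S(1) by (intro g_nonneg subspace_add subspace_scale)
    also have "\<dots> = a \<bullet> g a + t * (a \<bullet> g (g a)) + t * (g a \<bullet> g a) + t\<^sup>2 * (g a \<bullet> g (g a))"
      by (simp add: glin inner_add_left inner_add_right power2_eq_square algebra_simps)
    also have "a \<bullet> g (g a) = g a \<bullet> g a" by (simp add: gsym)
    finally show ?thesis by (simp add: g0)
  qed
  have "g a \<bullet> g a = 0"
  proof (rule ccontr)
    assume "g a \<bullet> g a \<noteq> 0"
    then have p: "g a \<bullet> g a > 0" by simp
    have q: "g a \<bullet> g (g a) \<ge> 0" by (rule g_nonneg[OF gaS])
    \<comment> \<open>Here the quadratic equals \<open>t * (g a \<bullet> g a) - t\<^sup>2\<close>,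
      which is negative; the \<open>+ 1\<close> keeps the denominator positive.\<close>
    define t where "t = - (g a \<bullet> g a) / (g a \<bullet> g (g a) + 1)"
    have t: "t < 0" using p q by (simp add: t_def)
    have "t * (g a \<bullet> g (g a) + 1) = - (g a \<bullet> g a)" using q by (simp add: t_def)
    then have "t * (g a \<bullet> g (g a)) = - (g a \<bullet> g a) - t"
      by (simp add: distrib_left)
    then have "t * (t * (g a \<bullet> g (g a))) = t * (- (g a \<bullet> g a) - t)"
      by simp
    then have "2 * t * (g a \<bullet> g a) + t\<^sup>2 * (g a \<bullet> g (g a)) = t * (g a \<bullet> g a) - t\<^sup>2"
      by (simp add: power2_eq_square right_diff_distrib)
    moreover have "t * (g a \<bullet> g a) < 0" using t p by (simp add: mult_neg_pos)
    ultimately show False using quad[of t] by (smt (verit) zero_le_power2)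
  qed
  then have "f a = l *\<^sub>R a" by (simp add: g_def)
  then show thesis using that aa(2) a by auto
qed

text \<open>Symmetry makes the orthogonal complement of an eigenvector in \<open>S\<close> invariant
  again, so an induction over invariant subspaces splits off one eigenvector at a time.\<close>

lemma symmetric_eigenbasis_of_subspace:
  fixes f :: "'a::euclidean_space \<Rightarrow> 'a"
  assumes f: "linear f" and sym: "\<And>x y. f x \<bullet> y = x \<bullet> f y"
    and "subspace S" "f ` S \<subseteq> S"
  shows "\<exists>B\<subseteq>S. finite B \<and> card B = dim S \<and> pairwise orthogonal B \<and>
           (\<forall>b\<in>B. norm b = 1 \<and> (\<exists>l. f b = l *\<^sub>R b))"
  using assms(3,4)
proof (induction "dim S" arbitrary: S)
  case 0
  then show ?case by (intro exI[of _ "{}"]) simp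
next
  case (Suc n)
  have "S \<noteq> {0}" using Suc.hyps(2) by auto
  then obtain a l where a: "a \<in> S" "norm a = 1" "f a = l *\<^sub>R a"
    using symmetric_eigenvector_in_subspace[OF f sym Suc.prems(1) _ Suc.prems(2)] by blast
  define T where "T = {y \<in> S. orthogonal a y}"
  have T: "subspace T"
    using Suc.prems(1) by (auto simp: T_def subspace_def orthogonal_clauses)
  have "f ` T \<subseteq> T"
  proof clarify
    fix y assume y: "y \<in> T"
    have "a \<bullet> f y = f a \<bullet> y" by (simp add: sym)
    then show "f y \<in> T" using y Suc.prems(2) by (auto simp: T_def a(3) orthogonal_def)
  qed
  moreover have "n = dim T"
  proof -
    have "{y \<in> S. \<forall>x \<in> span {a}. orthogonal x y} = T"
      by (auto simp: T_def span_singleton orthogonal_clauses intro: span_base)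
        (metis scaleR_one)
    moreover have "dim {y \<in> S. \<forall>x \<in> span {a}. orthogonal x y} + dim (span {a}) = dim S"
      using a(1) Suc.prems(1) by (intro dim_subspace_orthogonal_to_vectors) (auto simp: span_minimal)
    moreover have "dim (span {a}) = 1" using a(2) by (auto simp: dim_insert)
    ultimately show ?thesis using Suc.hyps(2) by simp
  qed
  ultimately obtain B where B: "B \<subseteq> T" "finite B" "card B = dim T" "pairwise orthogonal B"
      "\<forall>b\<in>B. norm b = 1 \<and> (\<exists>l. f b = l *\<^sub>R b)"
    using Suc.hyps(1)[OF _ T] by blast
  have "a \<notin> B" using B(1) a(2) by (auto simp: T_def orthogonal_self)
  moreover have "pairwise orthogonal (insert a B)"
    using B(1,4) by (auto simp: T_def pairwise_insert orthogonal_commute)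
  ultimately show ?case
    using a B \<open>n = dim T\<close> Suc.hyps(2) by (intro exI[of _ "insert a B"]) (auto simp: T_def)
qed

section \<open>Orthonormal frames and the Frobenius inner product\<close>

text \<open>Indexing by the coordinate type makes such a family automatically a basis and its matrix
  square.\<close>

definition orthonormal_frame :: "('n \<Rightarrow> real^'n) \<Rightarrow> bool" where
  "orthonormal_frame e \<longleftrightarrow> (\<forall>i j. e i \<bullet> e j = (if i = j then 1 else 0))"

lemma symmetric_eigenframe:
  fixes A :: "real^'n^'n"
  assumes "transpose A = A"
  obtains e l where "orthonormal_frame e" "\<And>i. A *v e i = l i *\<^sub>R e i"
proof -
  have sym: "(A *v x) \<bullet> y = x \<bullet> (A *v y)" for x y
    by (metis assms dot_lmul_matrix vector_transpose_matrix)
  obtain B :: "(real^'n) set" where B: "finite B" "card B = CARD('n)" "pairwise orthogonal B"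
      "\<forall>b\<in>B. norm b = 1 \<and> (\<exists>l. A *v b = l *\<^sub>R b)"
    using symmetric_eigenbasis_of_subspace[of "(*v) A" UNIV, OF _ sym] by auto
  obtain e where e: "bij_betw e (UNIV::'n set) B"
    using B(1,2) finite_same_card_bij[of "UNIV::'n set" B] by auto
  have "orthonormal_frame e"
    unfolding orthonormal_frame_def
    using B(3,4) e
    by (auto simp: pairwise_def orthogonal_def bij_betw_def inj_on_def norm_eq_1) metis
  moreover have "\<forall>i. \<exists>l. A *v e i = l *\<^sub>R e i"
    using B(4) e by (auto simp: bij_betw_def)
  then obtain l where "\<And>i. A *v e i = l i *\<^sub>R e i" by metis
  ultimately show thesis using that by blast
qed

text \<open>The frame forms the rows, so the first identity is orthonormality. The second holds
  because a right inverse of a square matrix is a left inverse; it is the completeness behind the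
  expansion and Parseval formulas.\<close>

lemma orthonormal_frame_orthogonal_matrix:
  assumes "orthonormal_frame e"
  shows "(\<chi> k. e k) ** transpose (\<chi> k. e k) = mat 1" "transpose (\<chi> k. e k) ** (\<chi> k. e k) = mat 1"
proof -
  show "(\<chi> k. e k) ** transpose (\<chi> k. e k) = mat 1"
    using assms
    by (simp add: orthonormal_frame_def matrix_matrix_mult_def transpose_def mat_def vec_eq_iff inner_vec_def)
  then show "transpose (\<chi> k. e k) ** (\<chi> k. e k) = mat 1"
    by (simp add: matrix_left_right_inverse)
qed

lemma orthonormal_frame_columns:
  fixes e :: "'n \<Rightarrow> real^'n"
  assumes "orthonormal_frame e"
  shows "(\<Sum>k\<in>UNIV. e k $ i * e k $ j) = (if i = j then 1 else 0)"
  using orthonormal_frame_orthogonal_matrix(2)[OF assms]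
  by (simp add: matrix_matrix_mult_def transpose_def mat_def vec_eq_iff)

lemma orthonormal_frame_expand:
  fixes e :: "'n \<Rightarrow> real^'n"
  assumes "orthonormal_frame e"
  shows "(\<Sum>k\<in>UNIV. (e k \<bullet> x) *\<^sub>R e k) = x"
proof -
  have "(\<Sum>k\<in>UNIV. (e k \<bullet> x) *\<^sub>R e k) $ i = x $ i" for i
  proof -
    have "(\<Sum>k\<in>UNIV. (e k \<bullet> x) *\<^sub>R e k) $ i = (\<Sum>j\<in>UNIV. x $ j * (\<Sum>k\<in>UNIV. e k $ j * e k $ i))"
      by (simp add: inner_vec_def sum_distrib_left sum_distrib_right mult_ac)
        (rule sum.swap)
    also have "\<dots> = x $ i"
      using assms by (simp add: orthonormal_frame_columns if_distrib cong: if_cong)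
    finally show ?thesis .
  qed
  then show ?thesis by (simp add: vec_eq_iff)
qed

lemma orthonormal_frame_parseval:
  fixes e :: "'n \<Rightarrow> real^'n"
  assumes "orthonormal_frame e"
  shows "(\<Sum>k\<in>UNIV. (e k \<bullet> x) * (e k \<bullet> y)) = x \<bullet> y"
proof -
  have "x \<bullet> y = (\<Sum>k\<in>UNIV. (e k \<bullet> x) *\<^sub>R e k) \<bullet> y"
    by (simp add: orthonormal_frame_expand assms)
  then show ?thesis by (simp add: inner_sum_left)
qed

lemma transpose_mult_inner:
  fixes X :: "real^'n^'m"
  shows "(transpose X *v x) \<bullet> y = x \<bullet> (X *v y)"
  by (simp add: transpose_matrix_vector dot_lmul_matrix)

text \<open>The Frobenius inner product is the trace of \<open>X Y^T\<close>, which any orthonormal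
  frame computes; Parseval is applied to each column.\<close>

lemma orthonormal_frame_matrix_inner:
  fixes e :: "'m \<Rightarrow> real^'m" and X Y :: "real^'n^'m"
  assumes "orthonormal_frame e"
  shows "(\<Sum>k\<in>UNIV. (transpose X *v e k) \<bullet> (transpose Y *v e k)) = X \<bullet> Y"
proof -
  have "(\<Sum>k\<in>UNIV. (transpose X *v e k) \<bullet> (transpose Y *v e k))
      = (\<Sum>k\<in>UNIV. \<Sum>j\<in>UNIV. (e k \<bullet> column j X) * (e k \<bullet> column j Y))"
    by (simp add: inner_vec_def matrix_vector_mult_def transpose_def column_def mult.commute)
  also have "\<dots> = (\<Sum>j\<in>UNIV. column j X \<bullet> column j Y)"
    by (subst sum.swap) (simp add: orthonormal_frame_parseval assms)
  also have "\<dots> = X \<bullet> Y"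
    by (simp add: inner_vec_def column_def) (rule sum.swap)
  finally show ?thesis .
qed

section \<open>Nuclear norm from an eigenframe, and duality\<close>

text \<open>The frame, lifted to constant polynomials, conjugates the characteristic matrix to a
  diagonal one. Its determinant is nonzero and cancels because polynomials form an integral
  domain.\<close>

lemma charpoly_eigenframe:
  fixes A :: "real^'n^'n"
  assumes e: "orthonormal_frame e" and l: "\<And>i. A *v e i = l i *\<^sub>R e i"
  shows "charpoly A = (\<Prod>i\<in>UNIV. [:- l i, 1:])"
proof -
  define Q :: "real poly^'n^'n" where "Q = (\<chi> k j. [:e k $ j:])"
  define M where "M = (\<chi> i j. (if i = j then [:0, 1:] else 0) - [:A $ i $ j:])"
  define D :: "real poly^'n^'n" where "D = (\<chi> i j. if i = j then [:- l i, 1:] else 0)"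
  have sum_const: "(\<Sum>k\<in>S. [:f k:]) = [:sum f S:]" for S :: "'n set" and f :: "'n \<Rightarrow> real"
    by (induction S rule: infinite_finite_induct) auto
  have QQ: "Q ** transpose Q = mat 1"
    using e
    by (auto simp: Q_def orthonormal_frame_def matrix_matrix_mult_def transpose_def mat_def vec_eq_iff
        inner_vec_def sum_const one_pCons)
  have le: "(\<Sum>j\<in>UNIV. A $ i $ j * e k $ j) = l k * e k $ i" for i k
    using l[of k] by (simp add: matrix_vector_mult_def vec_eq_iff)
  have "M ** transpose Q = transpose Q ** D"
  proof -
    have "(M ** transpose Q) $ i $ k = (transpose Q ** D) $ i $ k" for i k
    proof -
      have "(M ** transpose Q) $ i $ k =
          (\<Sum>j\<in>UNIV. (if i = j then [:0, e k $ j:] else 0)) - (\<Sum>j\<in>UNIV. [:A $ i $ j * e k $ j:])"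
        unfolding sum_subtractf[symmetric]
        by (auto simp: M_def Q_def matrix_matrix_mult_def transpose_def algebra_simps intro!: sum.cong)
      also have "\<dots> = [:- (l k * e k $ i), e k $ i:]"
        by (simp add: sum_const le)
      also have "\<dots> = (transpose Q ** D) $ i $ k"
        by (simp add: D_def Q_def matrix_matrix_mult_def transpose_def if_distrib mult.commute cong: if_cong)
      finally show ?thesis .
    qed
    then show ?thesis by (simp add: vec_eq_iff)
  qed
  then have "det (M ** transpose Q) = det (transpose Q ** D)"
    by simp
  then have MD: "det M * det Q = det D * det Q"
    by (simp add: det_mul mult.commute)
  have "det (Q ** transpose Q) = 1"
    by (simp add: QQ)
  then have "det Q \<noteq> 0"
    by (auto simp: det_mul)
  with MD have "det M = det D"
    by simp
  moreover have "det D = (\<Prod>i\<in>UNIV. D $ i $ i)"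
    by (intro det_diagonal) (simp add: D_def)
  ultimately show ?thesis by (simp add: charpoly_def M_def D_def)
qed

text \<open>Bridge from the definition by polynomial roots to spectral arguments: the multiset of
  roots becomes the family \<open>l\<close>, with multiplicity.\<close>

lemma nuclear_norm_eigenframe:
  fixes X :: "real^'n^'m"
  assumes e: "orthonormal_frame e" and l: "\<And>i. (X ** transpose X) *v e i = l i *\<^sub>R e i"
  shows "nuclear_norm X = (\<Sum>i\<in>UNIV. sqrt (l i))"
proof -
  have "proots (charpoly (X ** transpose X)) = (\<Sum>i\<in>UNIV. {#l i#})"
    unfolding charpoly_eigenframe[OF e l] by (subst proots_prod) auto
  moreover have "\<Sum>\<^sub># (image_mset sqrt (\<Sum>i\<in>S. {#l i#})) = (\<Sum>i\<in>S. sqrt (l i))" for S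
    by (induction S rule: infinite_finite_induct) auto
  ultimately show ?thesis by (simp add: nuclear_norm_def singular_values_def)
qed

text \<open>These are left singular vectors of \<open>X\<close>. Pairing the eigenvalue equation
  with \<open>e i\<close> identifies the eigenvalue, so the singular values are the lengths of
  \<open>transpose X *v e i\<close>.\<close>

lemma gram_eigenframe:
  fixes X :: "real^'n^'m"
  obtains e where "orthonormal_frame e"
    "\<And>i. (X ** transpose X) *v e i = (norm (transpose X *v e i))\<^sup>2 *\<^sub>R e i"
proof -
  obtain e l where e: "orthonormal_frame e" and l: "\<And>i. (X ** transpose X) *v e i = l i *\<^sub>R e i"
    using symmetric_eigenframe[of "X ** transpose X"] by (metis matrix_transpose_mul transpose_transpose)
  have "l i = (norm (transpose X *v e i))\<^sup>2" for i
  proof -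
    have "l i = e i \<bullet> ((X ** transpose X) *v e i)"
      using e by (simp add: l orthonormal_frame_def)
    also have "\<dots> = (transpose X *v e i) \<bullet> (transpose X *v e i)"
      by (simp add: transpose_mult_inner matrix_vector_mul_assoc)
    finally show ?thesis by (simp add: dot_square_norm)
  qed
  with e l that show thesis by simp
qed

text \<open>Half of the duality between nuclear and operator norm: expand in left singular vectors
  of \<open>X\<close> and apply Cauchy-Schwarz term by term.\<close>

lemma inner_le_nuclear_norm:
  fixes X Y :: "real^'n^'m"
  assumes "\<And>w. norm (transpose Y *v w) \<le> C * norm w"
  shows "X \<bullet> Y \<le> C * nuclear_norm X"
proof -
  obtain e where e: "orthonormal_frame e"
    and l: "\<And>i. (X ** transpose X) *v e i = (norm (transpose X *v e i))\<^sup>2 *\<^sub>R e i"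
    using gram_eigenframe[of X] by metis
  have "X \<bullet> Y = (\<Sum>k\<in>UNIV. (transpose X *v e k) \<bullet> (transpose Y *v e k))"
    by (simp add: orthonormal_frame_matrix_inner e)
  also have "\<dots> \<le> (\<Sum>k\<in>UNIV. norm (transpose X *v e k) * C)"
  proof (rule sum_mono)
    fix k
    have "norm (transpose Y *v e k) \<le> C"
      using assms[of "e k"] e by (simp add: orthonormal_frame_def norm_eq_sqrt_inner)
    then show "(transpose X *v e k) \<bullet> (transpose Y *v e k) \<le> norm (transpose X *v e k) * C"
      by (meson mult_left_mono norm_cauchy_schwarz norm_ge_zero order_trans)
  qed
  also have "\<dots> = C * nuclear_norm X"
    by (simp add: nuclear_norm_eigenframe[OF e l] sum_distrib_left mult.commute)
  finally show ?thesis .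
qed

text \<open>An eigenframe of \<open>B\<close> diagonalizes \<open>X ** transpose X\<close> with
  squared eigenvalues. Those of \<open>B\<close> being nonnegative, the square roots return them,
  and their sum is the trace.\<close>

lemma nuclear_norm_psd_square_root:
  fixes X :: "real^'n^'m" and B :: "real^'m^'m"
  assumes sym: "transpose B = B" and psd: "\<And>w. 0 \<le> w \<bullet> (B *v w)" and sq: "X ** transpose X = B ** B"
  shows "nuclear_norm X = trace B"
proof -
  obtain e l where e: "orthonormal_frame e" and l: "\<And>i. B *v e i = l i *\<^sub>R e i"
    using symmetric_eigenframe[OF sym] by metis
  have le: "e i \<bullet> (B *v e i) = l i" for i
    using e by (simp add: l orthonormal_frame_def)
  then have pos: "0 \<le> l i" for i using psd by metis
  have "(X ** transpose X) *v e i = (l i)\<^sup>2 *\<^sub>R e i" for i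
    unfolding sq
    by (simp add: l power2_eq_square matrix_vector_mult_scaleR flip: matrix_vector_mul_assoc)
  from nuclear_norm_eigenframe[OF e this] have "nuclear_norm X = (\<Sum>i\<in>UNIV. l i)"
    using pos by simp
  also have "\<dots> = (\<Sum>i\<in>UNIV. (transpose B *v e i) \<bullet> (transpose (mat 1) *v e i))"
    by (simp add: sym le inner_commute transpose_mat)
  also have "\<dots> = B \<bullet> mat 1"
    by (rule orthonormal_frame_matrix_inner[OF e])
  also have "\<dots> = trace B"
    by (simp add: inner_vec_def mat_def trace_def if_distrib cong: if_cong)
  finally show ?thesis .
qed

section \<open>Matrices \<open>U H V^T\<close> and the singular value decomposition\<close>

text \<open>The length \<open>r\<close> will be the rank of a matrix, a number rather than a type,
  so only the first \<open>r\<close> terms of a sequence are constrained.\<close>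

definition orthonormal_upto :: "nat \<Rightarrow> (nat \<Rightarrow> 'a::real_inner) \<Rightarrow> bool" where
  "orthonormal_upto r u \<longleftrightarrow> (\<forall>i<r. \<forall>j<r. u i \<bullet> u j = (if i = j then 1 else 0))"

lemma orthonormal_upto_inner_sum:
  assumes "orthonormal_upto r u" "i < r"
  shows "u i \<bullet> (\<Sum>j<r. c j *\<^sub>R u j) = c i"
proof -
  have "u i \<bullet> (\<Sum>j<r. c j *\<^sub>R u j) = (\<Sum>j<r. if i = j then c j else 0)"
    unfolding inner_sum_right using assms by (intro sum.cong) (auto simp: orthonormal_upto_def)
  then show ?thesis using assms(2) by simp
qed

lemma orthonormal_upto_inner_sums:
  assumes "orthonormal_upto r u"
  shows "(\<Sum>i<r. a i *\<^sub>R u i) \<bullet> (\<Sum>i<r. b i *\<^sub>R u i) = (\<Sum>i<r. a i * b i)"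
  by (simp add: inner_sum_left orthonormal_upto_inner_sum[OF assms])

definition outer :: "real^'m \<Rightarrow> real^'n \<Rightarrow> real^'n^'m" where
  "outer a b = (\<chi> i j. a $ i * b $ j)"

lemma outer_mult_vec: "outer a b *v x = (b \<bullet> x) *\<^sub>R a"
  by (simp add: outer_def vec_eq_iff matrix_vector_mult_def inner_vec_def mult.assoc
      flip: sum_distrib_left)

lemma inner_outer: "X \<bullet> outer a b = a \<bullet> (X *v b)"
  by (simp add: outer_def matrix_vector_mult_def inner_vec_def sum_distrib_left mult_ac)

lemma transpose_outer: "transpose (outer a b) = outer b a"
  by (simp add: outer_def transpose_def vec_eq_iff mult.commute)

lemma sum_matrix_vector_mult:
  fixes M :: "'i \<Rightarrow> real^'n^'m"
  shows "(\<Sum>i\<in>I. M i) *v x = (\<Sum>i\<in>I. M i *v x)"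
  by (induction I rule: infinite_finite_induct) (auto simp: matrix_vector_mult_add_rdistrib)

lemma sum_transpose:
  fixes M :: "'i \<Rightarrow> real^'n^'m"
  shows "transpose (\<Sum>i\<in>I. M i) = (\<Sum>i\<in>I. transpose (M i))"
  by (simp add: transpose_def vec_eq_iff)

text \<open>\<open>core u v r h\<close> is \<open>U H V\<^sup>T\<close>, where \<open>U\<close> and \<open>V\<close> have the first \<open>r\<close> vectors of \<open>u\<close>
  and \<open>v\<close> as columns and \<open>H\<close> is the \<open>r\<close> by \<open>r\<close> matrix \<open>h\<close>.\<close>

definition core
  :: "(nat \<Rightarrow> real^'m) \<Rightarrow> (nat \<Rightarrow> real^'n) \<Rightarrow> nat \<Rightarrow> (nat \<Rightarrow> nat \<Rightarrow> real) \<Rightarrow> real^'n^'m"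
  where
  "core u v r h = (\<Sum>i<r. \<Sum>j<r. h i j *\<^sub>R outer (u i) (v j))"

lemma core_mult_vec: "core u v r h *v x = (\<Sum>i<r. (\<Sum>j<r. h i j * (v j \<bullet> x)) *\<^sub>R u i)"
  by (simp add: core_def sum_matrix_vector_mult outer_mult_vec scaleR_sum_left
      flip: scaleR_matrix_vector_assoc)

lemma transpose_core: "transpose (core u v r h) = core v u r (\<lambda>i j. h j i)"
proof -
  have "transpose (core u v r h) = (\<Sum>i<r. \<Sum>j<r. h i j *\<^sub>R outer (v j) (u i))"
    by (simp add: core_def sum_transpose transpose_scalar transpose_outer)
  also have "\<dots> = core v u r (\<lambda>i j. h j i)"
    unfolding core_def by (rule sum.swap)
  finally show ?thesis .
qed

lemma inner_core: "X \<bullet> core u v r h = (\<Sum>i<r. \<Sum>j<r. h i j * (u i \<bullet> (X *v v j)))"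
  by (simp add: core_def inner_sum_right inner_outer)

lemma core_add: "core u v r g + core u v r h = core u v r (\<lambda>i j. g i j + h i j)"
  by (simp add: core_def sum.distrib scaleR_add_left)

lemma core_scale: "c *\<^sub>R core u v r h = core u v r (\<lambda>i j. c * h i j)"
  by (simp add: core_def scaleR_sum_right)

lemma core_diag: "core u v r (\<lambda>i j. if i = j then s i else 0) = (\<Sum>i<r. s i *\<^sub>R outer (u i) (v i))"
  by (simp add: core_def if_distrib[of "\<lambda>c. c *\<^sub>R _"] cong: if_cong)

lemma orthonormal_upto_core_inner:
  assumes "orthonormal_upto r u" "i < r"
  shows "u i \<bullet> (core u v r h *v x) = (\<Sum>j<r. h i j * (v j \<bullet> x))"
  unfolding core_mult_vec by (rule orthonormal_upto_inner_sum[OF assms])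

text \<open>Orthonormality of both families makes the passage from \<open>H\<close> to
  \<open>U H V^T\<close> an isometry.\<close>

lemma inner_core_core:
  assumes u: "orthonormal_upto r u" and v: "orthonormal_upto r v"
  shows "core u v r g \<bullet> core u v r h = (\<Sum>i<r. \<Sum>j<r. g i j * h i j)"
proof -
  have "u i \<bullet> (core u v r g *v v j) = g i j" if "i < r" "j < r" for i j
  proof -
    have "u i \<bullet> (core u v r g *v v j) = (\<Sum>k<r. if k = j then g i k else 0)"
      unfolding orthonormal_upto_core_inner[OF u that(1)]
      using v that(2) by (intro sum.cong) (auto simp: orthonormal_upto_def)
    then show ?thesis using that by simp
  qed
  then show ?thesis unfolding inner_core by (intro sum.cong) (auto simp: mult.commute)
qed

text \<open>Since \<open>V^T V\<close> is the identity, \<open>X X^T = U H^2 U^T\<close>. Hence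
  \<open>U H U^T\<close> is the positive semidefinite square root, and its trace is that of
  \<open>H\<close>.\<close>

lemma nuclear_norm_core:
  fixes u :: "nat \<Rightarrow> real^'m" and v :: "nat \<Rightarrow> real^'n"
  assumes u: "orthonormal_upto r u" and v: "orthonormal_upto r v"
    and sym: "\<And>i j. h i j = h j i" and psd: "\<And>a. 0 \<le> (\<Sum>i<r. \<Sum>j<r. h i j * (a i * a j))"
  shows "nuclear_norm (core u v r h) = (\<Sum>i<r. h i i)"
proof -
  let ?X = "core u v r h" and ?B = "core u u r h"
  have hT: "(\<lambda>i j. h j i) = h" by (intro ext) (rule sym)
  have "(?X ** transpose ?X) *v x = (?B ** ?B) *v x" for x
  proof -
    \<comment> \<open>\<open>V H U^T x\<close> and \<open>U H U^T x\<close> have the same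
      coordinates in their respective families, so the outer factor \<open>U H V^T\<close> or
      \<open>U H U^T\<close> sends them to the same vector.\<close>
    have "v j \<bullet> (core v u r h *v x) = u j \<bullet> (core u u r h *v x)" if "j < r" for j
      using that by (simp add: orthonormal_upto_core_inner u v)
    then have "?X *v (core v u r h *v x) = ?B *v (?B *v x)"
      unfolding core_mult_vec[of u v] core_mult_vec[of u u r h "?B *v x"] by simp
    moreover have "transpose ?X = core v u r h"
      by (simp only: transpose_core hT)
    ultimately show ?thesis
      by (simp add: matrix_vector_mul_assoc)
  qed
  then have "?X ** transpose ?X = ?B ** ?B"
    by (metis matrix_eq)
  moreover have "transpose ?B = ?B"
    by (simp only: transpose_core hT)
  moreover have "0 \<le> x \<bullet> (?B *v x)" for x
  proof -
    have "x \<bullet> (?B *v x) = (\<Sum>i<r. \<Sum>j<r. h i j * ((u i \<bullet> x) * (u j \<bullet> x)))"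
      by (simp add: core_mult_vec inner_sum_right sum_distrib_left inner_commute mult_ac)
    then show ?thesis using psd by simp
  qed
  ultimately have "nuclear_norm ?X = trace ?B"
    by (intro nuclear_norm_psd_square_root)
  also have "\<dots> = mat 1 \<bullet> ?B"
    by (simp add: inner_vec_def mat_def trace_def if_distrib[of "\<lambda>c. c * _"] cong: if_cong)
  also have "\<dots> = (\<Sum>i<r. \<Sum>j<r. if i = j then h i j else 0)"
    unfolding inner_core using u by (intro sum.cong) (auto simp: orthonormal_upto_def)
  also have "\<dots> = (\<Sum>i<r. h i i)" by simp
  finally show ?thesis .
qed

text \<open>Left singular vectors with nonzero image under \<open>X^T\<close> become
  \<open>u\<close>, and their normalized images become \<open>v\<close>.\<close>

lemma singular_value_decomposition:
  fixes X :: "real^'n^'m"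
  obtains u v s where "orthonormal_upto (rank X) u" "orthonormal_upto (rank X) v"
    "\<forall>i<rank X. 0 < s i"
    "X = core u v (rank X) (\<lambda>i j. if i = j then s i else 0)"
proof -
  obtain e where e: "orthonormal_frame e"
    and l: "\<And>i. (X ** transpose X) *v e i = (norm (transpose X *v e i))\<^sup>2 *\<^sub>R e i"
    using gram_eigenframe[of X] by metis
  define f where "f k = transpose X *v e k" for k
  define K where "K = {k. f k \<noteq> 0}"
  \<comment> \<open>The images are orthogonal because the \<open>e k\<close> are orthonormal
    eigenvectors of \<open>X X^T\<close>.\<close>
  have ff: "f k \<bullet> f l = (if k = l then (norm (f k))\<^sup>2 else 0)" for k l
  proof -
    have "f k \<bullet> f l = e k \<bullet> ((X ** transpose X) *v e l)"
      by (simp add: f_def transpose_mult_inner flip: matrix_vector_mul_assoc)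
    also have "\<dots> = (norm (f l))\<^sup>2 * (e k \<bullet> e l)" by (simp add: l f_def)
    finally show ?thesis using e by (auto simp: orthonormal_frame_def)
  qed
  have inj: "inj_on f K"
  proof (rule inj_onI)
    fix k l assume "k \<in> K" "l \<in> K" "f k = f l"
    then show "k = l" using ff[of k l] by (auto simp: K_def split: if_splits)
  qed
  have X: "X = (\<Sum>k\<in>K. outer (e k) (f k))"
  proof -
    have "X *v x = (\<Sum>k\<in>K. outer (e k) (f k)) *v x" for x
    proof -
      have "X *v x = (\<Sum>k\<in>UNIV. (f k \<bullet> x) *\<^sub>R e k)"
        unfolding f_def transpose_mult_inner by (rule orthonormal_frame_expand[OF e, symmetric])
      also have "\<dots> = (\<Sum>k\<in>K. (f k \<bullet> x) *\<^sub>R e k)"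
        by (intro sum.mono_neutral_right) (auto simp: K_def)
      finally show ?thesis by (simp add: sum_matrix_vector_mult outer_mult_vec)
    qed
    then show ?thesis by (metis matrix_eq)
  qed
  \<comment> \<open>The nonzero images form an orthogonal basis of the range of \<open>X^T\<close>,
    and transposition preserves rank.\<close>
  have "rank X = card K"
  proof -
    have "range (\<lambda>x. transpose X *v x) = span (f ` K)"
    proof
      have "transpose X *v x = (\<Sum>k\<in>K. (e k \<bullet> x) *\<^sub>R f k)" for x
        by (subst X) (simp add: sum_transpose transpose_outer sum_matrix_vector_mult outer_mult_vec)
      moreover have "(\<Sum>k\<in>K. (e k \<bullet> x) *\<^sub>R f k) \<in> span (f ` K)" for x
        by (intro span_sum span_scale span_base imageI)
      ultimately show "range (\<lambda>x. transpose X *v x) \<subseteq> span (f ` K)"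
        by auto
      show "span (f ` K) \<subseteq> range (\<lambda>x. transpose X *v x)"
        by (intro span_minimal linear_subspace_image) (auto simp: f_def)
    qed
    moreover have "independent (f ` K)"
      by (intro pairwise_orthogonal_independent)
        (auto simp: pairwise_def orthogonal_def ff K_def)
    ultimately have "rank (transpose X) = card (f ` K)"
      by (metis rank_dim_range dim_span_eq_card_independent)
    then show ?thesis using inj by (simp add: rank_transpose card_image)
  qed
  then obtain p where p: "bij_betw p {..<rank X} K"
    using finite_same_card_bij[of "{..<rank X}" K] by auto
  then have pK: "\<And>i. i < rank X \<Longrightarrow> f (p i) \<noteq> 0" by (auto simp: bij_betw_def K_def)
  have peq: "p i = p j \<longleftrightarrow> i = j" if "i < rank X" "j < rank X" for i j
    using p that by (auto simp: bij_betw_def inj_on_def)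
  define s where "s i = norm (f (p i))" for i
  define u where "u i = e (p i)" for i
  define v where "v i = f (p i) /\<^sub>R s i" for i
  show thesis
  proof (rule that)
    show "orthonormal_upto (rank X) u"
      using e by (auto simp: orthonormal_upto_def orthonormal_frame_def u_def peq)
    show "orthonormal_upto (rank X) v"
      using pK by (auto simp: orthonormal_upto_def v_def s_def ff peq power2_eq_square field_simps)
    show "\<forall>i<rank X. 0 < s i" using pK by (simp add: s_def)
    have "X = (\<Sum>i<rank X. outer (u i) (f (p i)))"
      by (subst X) (simp add: u_def sum.reindex_bij_betw[OF p, symmetric])
    also have "\<dots> = (\<Sum>i<rank X. s i *\<^sub>R outer (u i) (v i))"
    proof (rule sum.cong[OF refl])
      fix i assume "i \<in> {..<rank X}"
      then have "s i \<noteq> 0" using pK by (simp add: s_def)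
      then show "outer (u i) (f (p i)) = s i *\<^sub>R outer (u i) (v i)"
        by (simp add: outer_def v_def vec_eq_iff)
    qed
    finally show "X = core u v (rank X) (\<lambda>i j. if i = j then s i else 0)"
      by (simp add: core_diag)
  qed
qed

section \<open>Lower bound on the number of measurements\<close>

text \<open>Each linear condition lowers the dimension by at most one.\<close>

lemma common_kernel_nonzero:
  fixes S :: "'a::euclidean_space set" and \<phi> :: "nat \<Rightarrow> 'a \<Rightarrow> real"
  assumes "subspace S" "\<And>i. linear (\<phi> i)" "m < dim S"
  obtains x where "x \<in> S" "x \<noteq> 0" "\<And>i. i < m \<Longrightarrow> \<phi> i x = 0"
proof -
  define K where "K k = {x \<in> S. \<forall>i<k. \<phi> i x = 0}" for k
  have sub: "subspace (K k)" for k
    using assms(1,2) by (auto simp: K_def subspace_def linear_0 linear_add linear_scale)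
  have "dim (K k) \<le> dim (K (Suc k)) + 1" for k
  proof (cases "\<exists>a\<in>K k. \<phi> k a \<noteq> 0")
    case True
    then obtain a where a: "a \<in> K k" "\<phi> k a \<noteq> 0" by blast
    \<comment> \<open>Subtracting a suitable multiple of \<open>a\<close> moves any element of
      \<open>K k\<close> into \<open>K (Suc k)\<close>.\<close>
    have "K k \<subseteq> span (insert a (K (Suc k)))"
    proof
      fix x assume x: "x \<in> K k"
      let ?c = "\<phi> k x / \<phi> k a"
      have "x - ?c *\<^sub>R a \<in> K k"
        using x a(1) sub by (intro subspace_diff subspace_scale)
      moreover have "\<phi> k (x - ?c *\<^sub>R a) = 0"
        using assms(2) a(2) by (simp add: linear_diff linear_scale)
      ultimately have "x - ?c *\<^sub>R a \<in> K (Suc k)" by (auto simp: K_def less_Suc_eq)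
      then show "x \<in> span (insert a (K (Suc k)))"
        by (auto simp: span_breakdown_eq intro: span_base)
    qed
    then have "dim (K k) \<le> dim (insert a (K (Suc k)))"
      by (metis dim_span dim_subset)
    also have "\<dots> \<le> dim (K (Suc k)) + 1" by (simp add: dim_insert)
    finally show ?thesis .
  next
    case False
    then have "K (Suc k) = K k" by (auto simp: K_def less_Suc_eq)
    then show ?thesis by simp
  qed
  then have "dim (K 0) \<le> dim (K k) + k" for k
    by (induction k) (auto intro: order_trans)
  moreover have "K 0 = S" by (simp add: K_def)
  ultimately have "0 < dim (K m)" using assms(3) by (metis add_0 gr0I leD)
  then obtain x where "x \<in> K m" "x \<noteq> 0"
    by (metis dim_eq_0 less_irrefl singletonI subsetI)
  then show thesis using that by (auto simp: K_def)
qed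

text \<open>Lower-triangular positions index both an independent family of symmetric cores and the
  coordinates of the operator built later.\<close>

lemma card_triangle: "card (SIGMA j:{..<r::nat}. {..j}) = r * (r + 1) div 2"
proof -
  have "card (SIGMA j:{..<r}. {..j}) = (\<Sum>j<r. Suc j)" by (simp add: card_SigmaI)
  also have "\<dots> = r * (r + 1) div 2" by (induction r) auto
  finally show ?thesis .
qed

definition symmetric_cores :: "(nat \<Rightarrow> real^'m) \<Rightarrow> (nat \<Rightarrow> real^'n) \<Rightarrow> nat \<Rightarrow> (real^'n^'m) set" where
  "symmetric_cores u v r = {core u v r h | h. \<forall>i j. h i j = h j i}"

lemma subspace_symmetric_cores: "subspace (symmetric_cores u v r)"
proof (rule subspaceI)
  show "0 \<in> symmetric_cores u v r"
    unfolding symmetric_cores_def by (auto simp: core_def intro!: exI[of _ "\<lambda>_ _. 0"])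
next
  fix x y assume "x \<in> symmetric_cores u v r" "y \<in> symmetric_cores u v r"
  then obtain g h where *: "x = core u v r g" "\<forall>i j. g i j = g j i"
      "y = core u v r h" "\<forall>i j. h i j = h j i"
    unfolding symmetric_cores_def by blast
  then show "x + y \<in> symmetric_cores u v r"
    unfolding symmetric_cores_def mem_Collect_eq
    by (intro exI[of _ "\<lambda>i j. g i j + h i j"]) (auto simp: core_add)
next
  fix x c assume "x \<in> symmetric_cores u v r"
  then obtain g where *: "x = core u v r g" "\<forall>i j. g i j = g j i"
    unfolding symmetric_cores_def by blast
  then show "c *\<^sub>R x \<in> symmetric_cores u v r"
    unfolding symmetric_cores_def mem_Collect_eq
    by (intro exI[of _ "\<lambda>i j. c * g i j"]) (auto simp: core_scale)
qed

text \<open>The symmetrized matrix units, one for each lower-triangular position, are nonzero and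
  pairwise orthogonal.\<close>

lemma dim_symmetric_cores:
  assumes u: "orthonormal_upto r u" and v: "orthonormal_upto r v"
  shows "r * (r + 1) div 2 \<le> dim (symmetric_cores u v r)"
proof -
  let ?I = "SIGMA j:{..<r}. {..j}"
  define g :: "nat \<times> nat \<Rightarrow> nat \<Rightarrow> nat \<Rightarrow> real"
    where "g p i j = (if (i, j) = p \<or> (j, i) = p then 1 else 0)" for p i j
  define G where "G p = core u v r (g p)" for p
  \<comment> \<open>One equivalence records both facts: nonzero norm for equal indices,
    orthogonality for distinct ones.\<close>
  have GG: "G p \<bullet> G q = 0 \<longleftrightarrow> p \<noteq> q" if "p \<in> ?I" "q \<in> ?I" for p q
  proof (cases "p = q")
    case True
    obtain i j where p: "p = (i, j)" by force
    then have ij: "i < r" "j < r" using that by auto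
    have "0 < (\<Sum>i<r. \<Sum>j<r. g p i j * g p i j)"
      using ij by (intro sum_pos2[of _ i] sum_pos2[of _ j] sum_nonneg) (auto simp: g_def p)
    then show ?thesis using True by (simp add: G_def inner_core_core u v)
  next
    case False
    then have "g p i j * g q i j = 0" for i j
      using that by (auto simp: g_def)
    then show ?thesis using False by (simp only: G_def inner_core_core[OF u v]) simp
  qed
  have "inj_on G ?I"
    using GG by (metis (no_types, lifting) inj_onI)
  then have "card (G ` ?I) = r * (r + 1) div 2"
    by (simp only: card_image card_triangle)
  moreover have "independent (G ` ?I)"
  proof (rule pairwise_orthogonal_independent)
    show "pairwise orthogonal (G ` ?I)"
      using GG by (fastforce simp: pairwise_def orthogonal_def)
    show "0 \<notin> G ` ?I"
      using GG by (metis (no_types, lifting) imageE inner_zero_left)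
  qed
  moreover have "G ` ?I \<subseteq> symmetric_cores u v r"
    unfolding symmetric_cores_def G_def by (auto simp: g_def intro!: exI)
  ultimately show ?thesis
    by (metis (no_types, lifting) independent_card_le_dim)
qed

lemma nuclear_norm_core_diag:
  assumes "orthonormal_upto r u" "orthonormal_upto r v" "\<And>i. i < r \<Longrightarrow> 0 \<le> s i"
  shows "nuclear_norm (core u v r (\<lambda>i j. if i = j then s i else 0)) = (\<Sum>i<r. s i)"
proof -
  have "(\<Sum>j<r. (if i = j then s i else 0) * (a i * a j)) = (if i < r then s i * (a i * a i) else 0)" for i a
    by (simp add: if_distrib[of "\<lambda>c. c * _"] cong: if_cong)
  then show ?thesis
    using assms by (subst nuclear_norm_core) (auto intro!: sum_nonneg)
qed

text \<open>The bound on \<open>t\<close> keeps \<open>D + t H\<close> positive semidefinite, so that its trace is the nuclear norm.\<close>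

lemma nuclear_norm_core_affine:
  assumes u: "orthonormal_upto r u" and v: "orthonormal_upto r v"
    and s: "\<And>i. i < r \<Longrightarrow> \<mu> \<le> s i" and sym: "\<And>i j. h i j = h j i"
    and t: "\<bar>t\<bar> * (\<Sum>i<r. \<Sum>j<r. \<bar>h i j\<bar>) \<le> \<mu>"
  shows "nuclear_norm (core u v r (\<lambda>i j. if i = j then s i else 0) + t *\<^sub>R core u v r h)
    = (\<Sum>i<r. s i) + t * (\<Sum>i<r. h i i)"
proof -
  let ?g = "\<lambda>i j. (if i = j then s i else 0) + t * h i j"
  have psd: "0 \<le> (\<Sum>i<r. \<Sum>j<r. ?g i j * (a i * a j))" for a
  proof -
    define q where "q = (\<Sum>i<r. (a i)\<^sup>2)"
    have q0: "0 \<le> q" by (simp add: q_def sum_nonneg)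
    have aq: "\<bar>a i * a j\<bar> \<le> q" if "i < r" "j < r" for i j
    proof -
      have "(a k)\<^sup>2 \<le> q" if "k < r" for k
        unfolding q_def using that by (intro member_le_sum) auto
      from this[OF that(1)] this[OF that(2)] have "\<bar>a i\<bar> \<le> sqrt q" "\<bar>a j\<bar> \<le> sqrt q"
        by (simp_all add: real_le_rsqrt abs_le_square_iff q0)
      then have "\<bar>a i\<bar> * \<bar>a j\<bar> \<le> sqrt q * sqrt q" by (intro mult_mono) (auto simp: q0)
      then show ?thesis using q0 by (simp add: abs_mult)
    qed
    \<comment> \<open>The quadratic form of \<open>H\<close> is at most the sum of its absolute
      entries times \<open>q\<close>, while that of \<open>D\<close> is at least
      \<open>\<mu> * q\<close>; the bound on \<open>t\<close> lets \<open>D\<close>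
      dominate.\<close>
    have "\<bar>t * (\<Sum>i<r. \<Sum>j<r. h i j * (a i * a j))\<bar> \<le> \<bar>t\<bar> * (\<Sum>i<r. \<Sum>j<r. \<bar>h i j\<bar> * q)"
      unfolding abs_mult
      by (intro mult_left_mono order_trans[OF sum_abs] sum_mono)
        (auto simp only: abs_mult[of "h _ _"] lessThan_iff aq intro!: mult_left_mono)
    also have "\<dots> = (\<bar>t\<bar> * (\<Sum>i<r. \<Sum>j<r. \<bar>h i j\<bar>)) * q"
      by (simp add: sum_distrib_right mult.assoc)
    also have "\<dots> \<le> \<mu> * q" using t q0 by (rule mult_right_mono)
    also have "\<dots> \<le> (\<Sum>i<r. s i * (a i)\<^sup>2)"
      unfolding q_def sum_distrib_left using s by (intro sum_mono mult_right_mono) auto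
    finally have "0 \<le> (\<Sum>i<r. s i * (a i)\<^sup>2) + t * (\<Sum>i<r. \<Sum>j<r. h i j * (a i * a j))"
      by linarith
    also have "\<dots> = (\<Sum>i<r. \<Sum>j<r. ?g i j * (a i * a j))"
      by (simp add: distrib_right sum.distrib sum_distrib_left if_distrib[of "\<lambda>c. c * _"]
          power2_eq_square mult.assoc cong: if_cong)
    finally show ?thesis .
  qed
  have "nuclear_norm (core u v r ?g) = (\<Sum>i<r. ?g i i)"
    by (rule nuclear_norm_core[OF u v _ psd]) (auto simp: sym)
  then show ?thesis
    by (simp add: core_scale core_add sum.distrib sum_distrib_left)
qed

lemma strong_solution_measurements:
  fixes X :: "real^'n^'m" and \<Phi> :: "real^'n^'m \<Rightarrow> (nat \<Rightarrow> real)"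
  assumes lin: "linear_operator m \<Phi>" and strong: "strong_solution \<Phi> (\<Phi> X) X"
  shows "rank X * (rank X + 1) div 2 \<le> m"
proof (rule ccontr)
  assume "\<not> ?thesis"
  then have less: "m < rank X * (rank X + 1) div 2" by simp
  define r where "r = rank X"
  obtain u v s where u: "orthonormal_upto r u" and v: "orthonormal_upto r v"
    and "\<forall>i<r. 0 < s i" and X: "X = core u v r (\<lambda>i j. if i = j then s i else 0)"
    unfolding r_def by (rule singular_value_decomposition)
  then have s: "\<And>i. i < r \<Longrightarrow> 0 < s i" by blast
  have lin': "linear (\<lambda>Y. \<Phi> Y i)" for i using lin by (simp add: linear_operator_def)
  have "m < dim (symmetric_cores u v r)"
    using less dim_symmetric_cores[OF u v] by (simp add: r_def)
  then obtain H where H: "H \<in> symmetric_cores u v r" "H \<noteq> 0" and "\<And>i. i < m \<Longrightarrow> \<Phi> H i = 0"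
    using common_kernel_nonzero[OF subspace_symmetric_cores, of "\<lambda>i Y. \<Phi> Y i"] lin' by metis
  \<comment> \<open>Coordinates from \<open>m\<close> on vanish on all matrices, so \<open>H\<close>
    lies in the kernel of the whole operator.\<close>
  moreover have "\<Phi> H i = 0" if "m \<le> i" for i
    using lin that by (auto simp: linear_operator_def topspace_Euclidean_space image_subset_iff)
  ultimately have \<Phi>H: "\<Phi> H i = 0" for i by (meson not_le)
  obtain h where h: "H = core u v r h" and sym: "\<And>i j. h i j = h j i"
    using H(1) unfolding symmetric_cores_def by blast
  have "\<exists>\<mu>>0. \<forall>i<r. \<mu> \<le> s i"
  proof (intro exI conjI allI impI)
    \<comment> \<open>The inserted \<open>1\<close> keeps the set nonempty when
      \<open>r = 0\<close>.\<close>
    show "0 < Min (insert 1 (s ` {..<r}))" using s by (subst Min_gr_iff) auto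
    show "Min (insert 1 (s ` {..<r})) \<le> s i" if "i < r" for i using that by (intro Min_le) auto
  qed
  then obtain \<mu> where \<mu>: "0 < \<mu>" "\<And>i. i < r \<Longrightarrow> \<mu> \<le> s i" by blast
  obtain c \<epsilon> where c: "0 < c" and \<epsilon>: "0 < \<epsilon>"
    and growth: "\<And>Y. \<Phi> Y = \<Phi> X \<Longrightarrow> norm (Y - X) \<le> \<epsilon> \<Longrightarrow> c * (norm (Y - X))\<^sup>2 \<le> nuclear_norm Y - nuclear_norm X"
    using strong unfolding strong_solution_def by (metis (no_types, lifting))
  define M where "M = (\<Sum>i<r. \<Sum>j<r. \<bar>h i j\<bar>)"
  have M: "0 \<le> M" by (simp add: M_def sum_nonneg)
  \<comment> \<open>The first bound keeps \<open>X + t H\<close> and \<open>X - t H\<close> in the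
    ball where growth holds, the second where the nuclear norm is affine; \<open>M + 1\<close>
    avoids division by zero.\<close>
  define t where "t = min (\<epsilon> / norm H) (\<mu> / (M + 1))"
  have t: "0 < t" using \<epsilon> \<mu>(1) M H(2) by (simp add: t_def)
  have tH: "t * norm H \<le> \<epsilon>"
    using H(2) by (simp add: t_def pos_le_divide_eq[symmetric])
  have "t * (M + 1) \<le> \<mu>"
    using M by (simp add: t_def pos_le_divide_eq[symmetric])
  then have tM: "t * M \<le> \<mu>" using t by (simp add: distrib_left)
  have step: "c * (\<tau> * norm H)\<^sup>2 \<le> \<tau> * (\<Sum>i<r. h i i)" if "\<bar>\<tau>\<bar> = t" for \<tau>
  proof -
    have "\<Phi> (X + \<tau> *\<^sub>R H) i = \<Phi> X i" for i
      using lin'[of i] by (simp add: linear_add[of "\<lambda>Y. \<Phi> Y i"] linear_scale[of "\<lambda>Y. \<Phi> Y i"] \<Phi>H)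
    then have "\<Phi> (X + \<tau> *\<^sub>R H) = \<Phi> X" by blast
    moreover have "norm (X + \<tau> *\<^sub>R H - X) \<le> \<epsilon>" using tH that by simp
    ultimately have "c * (norm (X + \<tau> *\<^sub>R H - X))\<^sup>2 \<le> nuclear_norm (X + \<tau> *\<^sub>R H) - nuclear_norm X"
      by (rule growth)
    moreover have "nuclear_norm (X + \<tau> *\<^sub>R H) = (\<Sum>i<r. s i) + \<tau> * (\<Sum>i<r. h i i)"
      unfolding X h using tM that \<mu>(2) by (intro nuclear_norm_core_affine u v sym) (auto simp: M_def)
    moreover have "nuclear_norm X = (\<Sum>i<r. s i)"
      unfolding X using s by (intro nuclear_norm_core_diag u v) (simp add: less_imp_le)
    ultimately show ?thesis by (simp add: power_mult_distrib)
  qed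
  \<comment> \<open>In the estimates for \<open>t\<close> and \<open>- t\<close> the trace terms
    have opposite signs, so one of them contradicts positivity.\<close>
  have "0 < c * (t * norm H)\<^sup>2" using c t H(2) by simp
  with step[of t] step[of "- t"] t show False by simp
qed

section \<open>Quadratic growth when the symmetric part is measured\<close>

text \<open>The operator norm is at most the Frobenius norm: the squared length of
  \<open>H^T x\<close> is the pairing of \<open>H\<close> with a rank-one matrix, to which
  Cauchy-Schwarz applies.\<close>

lemma norm_transpose_mult_vec_le:
  fixes H :: "real^'n^'m"
  shows "norm (transpose H *v x) \<le> norm H * norm x"
proof -
  have "norm (transpose H *v x) ^ 2 = x \<bullet> (H *v (transpose H *v x))"
    by (simp add: dot_square_norm[symmetric] transpose_mult_inner)
  also have "\<dots> = H \<bullet> outer x (transpose H *v x)" by (simp add: inner_outer)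
  also have "\<dots> \<le> norm H * norm (outer x (transpose H *v x))" by (rule norm_cauchy_schwarz)
  also have "norm (outer x (transpose H *v x)) = norm x * norm (transpose H *v x)"
  proof -
    have "outer x y \<bullet> outer x y = (x \<bullet> x) * (y \<bullet> y)" for y :: "real^'n"
      by (simp add: inner_outer outer_mult_vec)
    then show ?thesis by (simp add: norm_eq_sqrt_inner real_sqrt_mult)
  qed
  finally have "norm (transpose H *v x) * norm (transpose H *v x) \<le> (norm H * norm x) * norm (transpose H *v x)"
    by (simp add: power2_eq_square mult_ac)
  then show ?thesis
    by (metis mult_nonneg_nonneg mult_right_le_imp_le norm_ge_zero less_eq_real_def)
qed

text \<open>The cross term in \<open>|E\<^sup>T w + \<tau> H\<^sup>T w|\<^sup>2\<close>, where \<open>E = U V\<^sup>T\<close>, sees only the component of \<open>w\<close> orthogonal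
  to the columns of \<open>U\<close>, which does not contribute to \<open>|E\<^sup>T w|\<^sup>2\<close>. So the operator norm of
  \<open>E + \<tau> H\<close> exceeds 1 only to second order in \<open>\<tau>\<close>.\<close>

lemma norm_polar_perturbation_le:
  fixes u :: "nat \<Rightarrow> real^'m" and v :: "nat \<Rightarrow> real^'n"
  assumes u: "orthonormal_upto r u" and v: "orthonormal_upto r v"
    and skew: "\<And>i j. i < r \<Longrightarrow> j < r \<Longrightarrow> u i \<bullet> (H *v v j) + u j \<bullet> (H *v v i) = 0"
  shows "norm (transpose (core u v r (\<lambda>i j. if i = j then 1 else 0) + \<tau> *\<^sub>R H) *v w)
    \<le> (1 + \<tau>\<^sup>2 * (norm H)\<^sup>2) * norm w"
proof -
  define a where "a i = u i \<bullet> w" for i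
  \<comment> \<open>\<open>p\<close> is the projection of \<open>w\<close> to the columns of
    \<open>U\<close>, \<open>z\<close> the remainder, and \<open>q = E^T w\<close> has the length of
    \<open>p\<close>.\<close>
  define p where "p = (\<Sum>i<r. a i *\<^sub>R u i)"
  define q where "q = (\<Sum>i<r. a i *\<^sub>R v i)"
  define z where "z = w - p"
  let ?k = "\<tau>\<^sup>2 * (norm H)\<^sup>2"
  have E: "transpose (core u v r (\<lambda>i j. if i = j then 1 else 0) + \<tau> *\<^sub>R H) *v w = q + \<tau> *\<^sub>R (transpose H *v w)"
  proof -
    have "transpose (A + \<tau> *\<^sub>R B) = transpose A + \<tau> *\<^sub>R transpose B" for A B :: "real^'n^'m"
      by (simp add: transpose_def vec_eq_iff)
    then have "transpose (core u v r (\<lambda>i j. if i = j then 1 else 0) + \<tau> *\<^sub>R H)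
        = core v u r (\<lambda>i j. if j = i then 1 else 0) + \<tau> *\<^sub>R transpose H"
      by (simp add: transpose_core)
    moreover have "core v u r (\<lambda>i j. if j = i then 1 else 0) *v w = q"
      by (simp add: core_mult_vec q_def a_def if_distrib[of "\<lambda>c. c * _"] cong: if_cong)
    ultimately show ?thesis
      by (simp add: matrix_vector_mult_add_rdistrib flip: scaleR_matrix_vector_assoc)
  qed
  have pp: "p \<bullet> p = q \<bullet> q"
    by (simp add: p_def q_def orthonormal_upto_inner_sums u v)
  have "p \<bullet> w = p \<bullet> p"
    by (simp add: p_def orthonormal_upto_inner_sums[OF u]) (simp add: inner_sum_left a_def)
  then have pz: "p \<bullet> z = 0" by (simp add: z_def inner_diff_right)
  have ww: "w \<bullet> w = q \<bullet> q + z \<bullet> z"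
  proof -
    have "w = p + z" by (simp add: z_def)
    then show ?thesis
      using pz by (simp add: inner_add_left inner_add_right inner_commute pp)
  qed
  \<comment> \<open>This is the quadratic form of \<open>U^T H V\<close> at the coordinates
    \<open>a\<close>; it vanishes because that matrix is skew-symmetric.\<close>
  have "q \<bullet> (transpose H *v p) = 0"
  proof -
    let ?f = "\<lambda>i j. a i * a j * (u i \<bullet> (H *v v j))"
    have "q \<bullet> (transpose H *v p) = p \<bullet> (H *v q)"
      by (simp add: inner_commute[of q] transpose_mult_inner)
    also have "\<dots> = (\<Sum>i<r. \<Sum>j<r. ?f i j)"
    proof -
      have "H *v q = (\<Sum>j<r. a j *\<^sub>R (H *v v j))"
        by (simp add: q_def linear_sum[OF matrix_vector_mul_linear] matrix_vector_mult_scaleR)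
      moreover have "p \<bullet> x = (\<Sum>i<r. a i * (u i \<bullet> x))" for x
        by (simp add: p_def inner_sum_left)
      ultimately show ?thesis
        by (simp add: inner_sum_right sum_distrib_left mult.assoc)
          (subst sum.swap, simp add: mult.left_commute)
    qed
    finally have f: "q \<bullet> (transpose H *v p) = (\<Sum>i<r. \<Sum>j<r. ?f i j)" .
    have "(\<Sum>i<r. \<Sum>j<r. ?f i j) + (\<Sum>i<r. \<Sum>j<r. ?f j i)
        = (\<Sum>i<r. \<Sum>j<r. a i * a j * (u i \<bullet> (H *v v j) + u j \<bullet> (H *v v i)))"
      by (simp add: sum.distrib[symmetric] distrib_left mult_ac)
    also have "\<dots> = 0" using skew by simp
    finally have "(\<Sum>i<r. \<Sum>j<r. ?f i j) + (\<Sum>i<r. \<Sum>j<r. ?f j i) = 0" .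
    moreover have "(\<Sum>i<r. \<Sum>j<r. ?f j i) = (\<Sum>i<r. \<Sum>j<r. ?f i j)" by (rule sum.swap)
    ultimately show ?thesis by (simp add: f)
  qed
  then have qH: "q \<bullet> (transpose H *v w) = q \<bullet> (transpose H *v z)"
    by (simp add: z_def matrix_vector_mult_diff_distrib inner_diff_right)
  \<comment> \<open>The arithmetic-geometric mean inequality is weighted so that \<open>z\<close>
    enters with coefficient 1: exactly the slack
    \<open>w \<bullet> w - q \<bullet> q\<close>.\<close>
  have "2 * \<tau> * (q \<bullet> (transpose H *v z)) \<le> z \<bullet> z + ?k * (q \<bullet> q)"
  proof -
    have "\<tau> * (q \<bullet> (transpose H *v z)) \<le> \<bar>\<tau>\<bar> * (norm q * (norm H * norm z))"
    proof -
      have "\<bar>q \<bullet> (transpose H *v z)\<bar> \<le> norm q * norm (transpose H *v z)"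
        by (rule Cauchy_Schwarz_ineq2)
      also have "\<dots> \<le> norm q * (norm H * norm z)"
        by (intro mult_left_mono norm_transpose_mult_vec_le) simp
      finally have "\<bar>\<tau>\<bar> * \<bar>q \<bullet> (transpose H *v z)\<bar> \<le> \<bar>\<tau>\<bar> * (norm q * (norm H * norm z))"
        by (rule mult_left_mono) simp
      then show ?thesis by (simp add: abs_mult[symmetric])
    qed
    moreover have "2 * (\<bar>\<tau>\<bar> * norm H * norm q * norm z) \<le> (\<bar>\<tau>\<bar> * norm H * norm q)\<^sup>2 + (norm z)\<^sup>2"
      using sum_squares_bound[of "\<bar>\<tau>\<bar> * norm H * norm q" "norm z"] by simp
    ultimately show ?thesis
      by (simp add: power_mult_distrib dot_square_norm mult_ac)
  qed
  moreover have "\<tau>\<^sup>2 * (norm (transpose H *v w))\<^sup>2 \<le> ?k * (w \<bullet> w)"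
  proof -
    have "(norm (transpose H *v w))\<^sup>2 \<le> (norm H * norm w)\<^sup>2"
      by (intro power_mono norm_transpose_mult_vec_le) simp
    then have "\<tau>\<^sup>2 * (norm (transpose H *v w))\<^sup>2 \<le> \<tau>\<^sup>2 * (norm H * norm w)\<^sup>2"
      by (rule mult_left_mono) simp
    then show ?thesis by (simp add: power_mult_distrib dot_square_norm mult_ac)
  qed
  moreover have "(norm (q + \<tau> *\<^sub>R (transpose H *v w)))\<^sup>2
      = q \<bullet> q + 2 * \<tau> * (q \<bullet> (transpose H *v w)) + \<tau>\<^sup>2 * (norm (transpose H *v w))\<^sup>2"
    unfolding power2_norm_eq_inner
    by (simp add: inner_add_left inner_add_right inner_commute power2_eq_square algebra_simps)
  moreover have "?k * (q \<bullet> q) \<le> ?k * (w \<bullet> w)" by (intro mult_left_mono) (simp_all add: ww)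
  ultimately have "(norm (q + \<tau> *\<^sub>R (transpose H *v w)))\<^sup>2 \<le> (1 + 2 * ?k) * (w \<bullet> w)"
    using ww qH by (simp add: distrib_right)
  also have "\<dots> \<le> (1 + ?k)\<^sup>2 * (w \<bullet> w)"
    by (intro mult_right_mono) (simp_all add: power2_sum)
  also have "\<dots> = ((1 + ?k) * norm w)\<^sup>2"
    by (simp add: power_mult_distrib dot_square_norm)
  finally show ?thesis unfolding E
    by (rule power2_le_imp_le) (simp add: add_nonneg_nonneg)
qed

text \<open>Pairing with \<open>E + \<tau> H\<close> gains \<open>\<tau>\<close> times the squared
  norm of \<open>H\<close>. Since \<open>\<tau>\<close> depends on \<open>X\<close> only, the growth
  constant is uniform in \<open>H\<close>.\<close>

lemma nuclear_norm_growth: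
  fixes u :: "nat \<Rightarrow> real^'m" and v :: "nat \<Rightarrow> real^'n"
  assumes u: "orthonormal_upto r u" and v: "orthonormal_upto r v"
    and s: "\<And>i. i < r \<Longrightarrow> 0 \<le> s i" and X: "X = core u v r (\<lambda>i j. if i = j then s i else 0)"
    and skew: "\<And>i j. i < r \<Longrightarrow> j < r \<Longrightarrow> u i \<bullet> (H *v v j) + u j \<bullet> (H *v v i) = 0"
    and H: "norm H \<le> 1" and \<tau>: "\<tau> = 1 / (4 * (nuclear_norm X + 1))"
  shows "nuclear_norm X + \<tau> / 2 * (norm H)\<^sup>2 \<le> nuclear_norm (X + H)"
proof -
  let ?E = "core u v r (\<lambda>i j. if i = j then 1 else 0)"
  define S where "S = (\<Sum>i<r. s i)"
  have nX: "nuclear_norm X = S" unfolding X S_def by (intro nuclear_norm_core_diag u v s)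
  have S: "0 \<le> S" unfolding S_def by (intro sum_nonneg) (simp add: s)
  have \<tau>0: "0 < \<tau>" and \<tau>S: "\<tau> * S \<le> 1 / 4" and \<tau>1: "\<tau> \<le> 1 / 4"
    using S by (simp_all add: \<tau> nX field_simps)
  define k where "k = (norm H)\<^sup>2"
  have k: "0 \<le> k" "k \<le> 1" using H by (simp_all add: k_def power_le_one)
  \<comment> \<open>The skew matrix \<open>U^T H V\<close> has zero diagonal, so \<open>H\<close> is
    orthogonal to both \<open>E\<close> and \<open>X\<close>.\<close>
  have diag0: "u i \<bullet> (H *v v i) = 0" if "i < r" for i using skew[OF that that] by simp
  have HE: "H \<bullet> ?E = 0"
    unfolding inner_core by (intro sum.neutral) (auto simp: diag0 intro!: sum.neutral)
  have HX: "H \<bullet> X = 0"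
    unfolding inner_core X by (intro sum.neutral) (auto simp: diag0 intro!: sum.neutral)
  have XE: "X \<bullet> ?E = S"
    unfolding X inner_core_core[OF u v] by (simp add: S_def if_distrib[of "\<lambda>c. c * _"] cong: if_cong)
  have "(X + H) \<bullet> (?E + \<tau> *\<^sub>R H) = S + \<tau> * k"
    by (simp add: inner_add_left inner_add_right HE HX XE inner_commute[of X H] k_def dot_square_norm)
  moreover have "(X + H) \<bullet> (?E + \<tau> *\<^sub>R H) \<le> (1 + \<tau>\<^sup>2 * k) * nuclear_norm (X + H)"
    unfolding k_def by (intro inner_le_nuclear_norm norm_polar_perturbation_le u v skew)
  \<comment> \<open>The choice of \<open>\<tau>\<close> makes both \<open>\<tau> * S\<close> and
    \<open>\<tau>\<close> at most 1/4, so enlarging the operator norm costs at most half of the gain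
    \<open>\<tau> * k\<close>.\<close>
  moreover have "(1 + \<tau>\<^sup>2 * k) * (S + \<tau> / 2 * k) \<le> S + \<tau> * k"
  proof -
    have 1: "(\<tau> * k) * (\<tau> * S) \<le> (\<tau> * k) * (1 / 4)"
      using \<tau>0 k \<tau>S by (intro mult_left_mono) auto
    have "\<tau> * (\<tau> * k) \<le> (1 / 4) * 1"
      using \<tau>0 k \<tau>1 by (intro mult_mono mult_le_one) auto
    then have 2: "(\<tau> * k) * (\<tau> * (\<tau> * k)) \<le> (\<tau> * k) * (1 / 4)"
      using \<tau>0 k by (intro mult_left_mono) auto
    have 3: "0 \<le> \<tau> * k" using \<tau>0 k by simp
    have "(1 + \<tau>\<^sup>2 * k) * (S + \<tau> / 2 * k) = S + \<tau> * k / 2 + (\<tau> * k) * (\<tau> * S) + (\<tau> * k) * (\<tau> * (\<tau> * k)) / 2"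
      by (simp add: power2_eq_square field_simps)
    also have "\<dots> \<le> S + \<tau> * k" using 1 2 3 by linarith
    finally show ?thesis .
  qed
  ultimately have "(1 + \<tau>\<^sup>2 * k) * (S + \<tau> / 2 * k) \<le> (1 + \<tau>\<^sup>2 * k) * nuclear_norm (X + H)"
    by linarith
  moreover have "0 < 1 + \<tau>\<^sup>2 * k" using k by (simp add: add_pos_nonneg)
  ultimately show ?thesis by (simp add: nX k_def)
qed

text \<open>The last conclusion serves to tell different multiples of the operator apart by their
  values at \<open>X\<close>.\<close>

lemma strong_solution_exists_operator:
  fixes X :: "real^'n^'m"
  obtains \<Phi> :: "real^'n^'m \<Rightarrow> (nat \<Rightarrow> real)"
    where "linear_operator (rank X * (rank X + 1) div 2) \<Phi>" "strong_solution \<Phi> (\<Phi> X) X"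
      "rank X \<noteq> 0 \<longrightarrow> \<Phi> X \<noteq> (\<lambda>_. 0)"
proof -
  define r where "r = rank X"
  obtain u v s where u: "orthonormal_upto r u" and v: "orthonormal_upto r v"
    and "\<forall>i<r. 0 < s i" and X: "X = core u v r (\<lambda>i j. if i = j then s i else 0)"
    unfolding r_def by (rule singular_value_decomposition)
  then have s: "\<And>i. i < r \<Longrightarrow> 0 < s i" by blast
  let ?m = "r * (r + 1) div 2" and ?I = "SIGMA j:{..<r}. {..j}"
  obtain p where p: "bij_betw p {..<?m} ?I"
    using finite_same_card_bij[of "{..<?m}" ?I]
    by (auto simp only: card_triangle card_lessThan finite_SigmaI finite_lessThan finite_atMost)
  \<comment> \<open>\<open>L i j Y\<close> is twice the \<open>(i, j)\<close> entry of the symmetric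
    part of \<open>U^T Y V\<close>.\<close>
  define L where "L i j Y = u i \<bullet> (Y *v v j) + u j \<bullet> (Y *v v i)" for i j and Y :: "real^'n^'m"
  have L: "linear (L i j)" for i j
    unfolding L_def
    by (rule linearI) (simp_all add: matrix_vector_mult_add_rdistrib inner_add_right distrib_left
        flip: scaleR_matrix_vector_assoc)
  \<comment> \<open>The default 0 from \<open>?m\<close> on places the values in the required
    coordinate space.\<close>
  define \<Phi> where "\<Phi> Y k = (if k < ?m then case_prod L (p k) Y else 0)" for Y k
  have \<Phi>L: "\<exists>k. \<forall>Y. \<Phi> Y k = L i j Y" if "i < r" "j < r" for i j
  proof -
    have *: "\<exists>k. \<forall>Y. \<Phi> Y k = L i j Y" if "i < r" "j \<le> i" for i j
    proof -
      have "(i, j) \<in> p ` {..<?m}" using p that by (auto simp: bij_betw_def)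
      then obtain k where "k < ?m" "p k = (i, j)" by (metis imageE lessThan_iff)
      then have "\<forall>Y. \<Phi> Y k = L i j Y" unfolding \<Phi>_def by simp
      then show ?thesis ..
    qed
    have "L i j = L j i" by (simp add: L_def fun_eq_iff add.commute)
    then show ?thesis using * that by (metis nle_le)
  qed
  show thesis
  proof (rule that[of \<Phi>])
    have "linear (\<lambda>Y. \<Phi> Y k)" for k
      unfolding \<Phi>_def using L by (cases "p k"; cases "k < ?m") (auto simp: linear_zero)
    then show "linear_operator (rank X * (rank X + 1) div 2) \<Phi>"
      by (auto simp: linear_operator_def topspace_Euclidean_space \<Phi>_def r_def)
    define \<tau> where "\<tau> = 1 / (4 * (nuclear_norm X + 1))"
    have "nuclear_norm X = (\<Sum>i<r. s i)"
      unfolding X using s by (intro nuclear_norm_core_diag u v) (simp add: less_imp_le)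
    moreover have "0 \<le> (\<Sum>i<r. s i)"
      using s by (intro sum_nonneg) (simp add: less_imp_le)
    ultimately have "0 \<le> nuclear_norm X" by simp
    then have "0 < \<tau> / 2" by (simp add: \<tau>_def)
    moreover have "\<tau> / 2 * (norm (Y - X))\<^sup>2 \<le> nuclear_norm Y - nuclear_norm X"
      if Y: "\<Phi> Y = \<Phi> X" "norm (Y - X) \<le> 1" for Y
    proof -
      have "L i j (Y - X) = 0" if "i < r" "j < r" for i j
      proof -
        have "L i j Y = L i j X" using \<Phi>L[OF that] Y(1) by metis
        then show ?thesis using linear_diff[OF L, of i j Y X] by simp
      qed
      then have skew: "u i \<bullet> ((Y - X) *v v j) + u j \<bullet> ((Y - X) *v v i) = 0" if "i < r" "j < r" for i j
        using that by (simp only: L_def)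
      have "nuclear_norm X + \<tau> / 2 * (norm (Y - X))\<^sup>2 \<le> nuclear_norm (X + (Y - X))"
        using s by (intro nuclear_norm_growth[OF u v _ X skew Y(2) \<tau>_def]) (simp add: less_imp_le)
      then show ?thesis by simp
    qed
    ultimately show "strong_solution \<Phi> (\<Phi> X) X"
      unfolding strong_solution_def
      by (intro conjI exI[of _ "\<tau> / 2"] exI[of _ "1::real"]) auto
    show "rank X \<noteq> 0 \<longrightarrow> \<Phi> X \<noteq> (\<lambda>_. 0)"
    proof
      assume "rank X \<noteq> 0"
      then have r: "0 < r" by (simp add: r_def)
      have "u 0 \<bullet> (X *v v 0) = (\<Sum>j<r. if j = 0 then s 0 else 0)"
        unfolding X orthonormal_upto_core_inner[OF u r]
        using v r by (intro sum.cong) (auto simp: orthonormal_upto_def)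
      then have "L 0 0 X = 2 * s 0" using r by (simp add: L_def)
      then show "\<Phi> X \<noteq> (\<lambda>_. 0)" using \<Phi>L[OF r r] s[OF r] by (metis less_irrefl mult_eq_0_iff zero_neq_numeral)
    qed
  qed
qed

section \<open>Rescaling and infinitely many operators\<close>

lemma linear_operator_scale:
  fixes \<Phi> :: "real^'n^'m \<Rightarrow> (nat \<Rightarrow> real)"
  assumes "linear_operator m \<Phi>"
  shows "linear_operator m (\<lambda>X i. c * \<Phi> X i)"
proof -
  have "linear (\<lambda>X. c * \<Phi> X i)" for i
    using linear_compose_scale_right[of "\<lambda>X. \<Phi> X i" c] assms by (simp add: linear_operator_def)
  moreover have "c * \<Phi> X i = 0" if "m \<le> i" for X i
    using assms that by (simp add: linear_operator_def topspace_Euclidean_space image_subset_iff)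
  ultimately show ?thesis
    by (simp add: linear_operator_def topspace_Euclidean_space image_subset_iff)
qed

text \<open>A nonzero factor leaves the feasible set unchanged.\<close>

lemma strong_solution_scale:
  fixes c :: real and \<Phi> :: "real^'n^'m \<Rightarrow> (nat \<Rightarrow> real)"
  assumes "c \<noteq> 0" "strong_solution \<Phi> (\<Phi> X) X"
  shows "strong_solution (\<lambda>Y i. c * \<Phi> Y i) (\<lambda>i. c * \<Phi> X i) X"
proof -
  have "(\<lambda>i. c * \<Phi> Y i) = (\<lambda>i. c * \<Phi> X i) \<longleftrightarrow> \<Phi> Y = \<Phi> X" for Y
    using assms(1) by (auto simp: fun_eq_iff)
  then show ?thesis using assms(2) by (simp add: strong_solution_def)
qed

text \<open>Infinitude is asserted for \<open>r \<ge> 1\<close>: when \<open>r = 0\<close> the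
  target space is a point and the zero map is the only operator. Existence is stated separately and
  covers that case.\<close>

theorem corollary5p8:
  fixes X\<^sub>0 :: "real^'n2^'n1" and r :: nat
  assumes "CARD('n1) \<le> CARD('n2)"
    and "rank X\<^sub>0 = r"
  shows "(\<forall>m. \<forall>\<Phi> :: real^'n2^'n1 \<Rightarrow> (nat \<Rightarrow> real).
            linear_operator m \<Phi> \<and> strong_solution \<Phi> (\<Phi> X\<^sub>0) X\<^sub>0 \<longrightarrow>
            real m \<ge> 1 / 2 * real r * (real r + 1)) \<and>
         (\<exists>\<Phi> :: real^'n2^'n1 \<Rightarrow> (nat \<Rightarrow> real).
            linear_operator (r * (r + 1) div 2) \<Phi> \<and> strong_solution \<Phi> (\<Phi> X\<^sub>0) X\<^sub>0) \<and>
         (r \<ge> 1 \<longrightarrow>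
            infinite {\<Phi> :: real^'n2^'n1 \<Rightarrow> (nat \<Rightarrow> real).
              linear_operator (r * (r + 1) div 2) \<Phi> \<and> strong_solution \<Phi> (\<Phi> X\<^sub>0) X\<^sub>0})"
proof (intro conjI allI impI)
  fix m and \<Phi> :: "real^'n2^'n1 \<Rightarrow> (nat \<Rightarrow> real)"
  assume "linear_operator m \<Phi> \<and> strong_solution \<Phi> (\<Phi> X\<^sub>0) X\<^sub>0"
  then have "r * (r + 1) div 2 \<le> m"
    using strong_solution_measurements assms(2) by blast
  then have "real (r * (r + 1) div 2) \<le> real m" by (rule of_nat_mono)
  \<comment> \<open>The natural division is exact, as \<open>r * (r + 1)\<close> is even.\<close>
  moreover have "real (r * (r + 1) div 2) = 1 / 2 * real r * (real r + 1)"
    by (subst real_of_nat_div) (auto simp: algebra_simps)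
  ultimately show "real m \<ge> 1 / 2 * real r * (real r + 1)" by simp
next
  show "\<exists>\<Phi> :: real^'n2^'n1 \<Rightarrow> (nat \<Rightarrow> real).
      linear_operator (r * (r + 1) div 2) \<Phi> \<and> strong_solution \<Phi> (\<Phi> X\<^sub>0) X\<^sub>0"
    by (rule strong_solution_exists_operator[of X\<^sub>0]) (use assms(2) in blast)
next
  let ?A = "{\<Phi> :: real^'n2^'n1 \<Rightarrow> (nat \<Rightarrow> real).
      linear_operator (r * (r + 1) div 2) \<Phi> \<and> strong_solution \<Phi> (\<Phi> X\<^sub>0) X\<^sub>0}"
  assume "r \<ge> 1"
  obtain \<Phi> :: "real^'n2^'n1 \<Rightarrow> (nat \<Rightarrow> real)"
    where "linear_operator (rank X\<^sub>0 * (rank X\<^sub>0 + 1) div 2) \<Phi>" "strong_solution \<Phi> (\<Phi> X\<^sub>0) X\<^sub>0"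
      "rank X\<^sub>0 \<noteq> 0 \<longrightarrow> \<Phi> X\<^sub>0 \<noteq> (\<lambda>_. 0)"
    by (rule strong_solution_exists_operator)
  with assms(2) \<open>r \<ge> 1\<close> have \<Phi>: "\<Phi> \<in> ?A" "\<Phi> X\<^sub>0 \<noteq> (\<lambda>_. 0)"
    by auto
  then obtain k where k: "\<Phi> X\<^sub>0 k \<noteq> 0" by blast
  let ?f = "\<lambda>c Y i. c * \<Phi> Y i"
  \<comment> \<open>The factor \<open>c\<close> can be read off from the nonzero coordinate
    \<open>k\<close> at \<open>X\<^sub>0\<close>.\<close>
  have "inj_on ?f {0<..}"
    using k by (auto simp: inj_on_def fun_eq_iff)
  moreover have "?f ` {0<..} \<subseteq> ?A"
    using \<Phi>(1) by (auto intro: linear_operator_scale strong_solution_scale)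
  moreover have "infinite {0::real<..}" by (rule infinite_Ioi)
  ultimately show "infinite ?A"
    by (meson finite_imageD finite_subset)
qed

end
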